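(* If $X$ is a compressed unbounded path metric space, then $X$ is quasi-isometric to $\mathbb{R}$ or to $\mathbb{R}_+$.
   Context: $\mathbb{R}_+=[0,\infty)$. A path metric space is a metric space $X$ such that for all $x,y\in X$, $d(x,y)$ equals the infimum of the lengths of continuous paths in $X$ connecting $x$ to $y$. For $\epsilon\ge 0$, a continuous curve $\gamma:[a,b]\to X$ is an $\epsilon$-geodesic if $\mathrm{length}(\gamma)\le d(\gamma(a),\gamma(b))+\epsilon$. Tripods: let $x,y,z,o\in X$ and let $\mu$ be an $\epsilon$-geodesic connecting $x$ to $y$ and passing through $o$, such that $d(z,o)\le d(z,w)+\epsilon$ for every $w\in\mu$. Then $\mu$ is the concatenation $\alpha\cup\beta$ of $\epsilon$-geodesics $\alpha,\beta$ connecting $x$, $y$ respectively to $o$. Let $\gamma$ be an $\epsilon$-geodesic connecting $z$ to $o$. Then $T=\alpha\cup\beta\cup\gamma$ is called a tripod with vertices $x,y,z$, legs $\alpha,\beta,\gamma$ and center $o$. If $\alpha,\beta,\gamma$ all have length at least $R$, then $T$ is called an $(R,\epsilon)$-tripod. $X$ is $(R,\epsilon)$-compressed if it contains no $(R,\epsilon)$-tripods. $X$ is uncompressed if it is not $(R,\epsilon)$-compressed for any $R<\infty$, $\epsilon>0$. $X$ is compressed if it is not uncompressed, i.e. if it is $(R,\epsilon)$-compressed for some $R<\infty$ and some $\epsilon>0$. A map $f:X\to Y$ of metric spaces is an $(L,A)$-quasi-isometry ($L\ge 1$, $A\in\mathbb{R}$) if $L^{-1}d(x_1,x_2)-A\le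 d(f(x_1),f(x_2))\le L\,d(x_1,x_2)+A$ for all $x_1,x_2\in X$ and every point of $Y$ is at distance $\le A$ from $f(X)$. $X$ and $Y$ are quasi-isometric if there is an $(L,A)$-quasi-isometry $X\to Y$ for some $L,A$. *)

theory Defs
  imports "HOL-Analysis.Analysis"
begin

text \<open>
  Metric spaces are rendered as arbitrary subsets \<open>X\<close> of a type of class
  \<^class>\<open>metric_space\<close>, with the restricted distance; taking \<open>X = UNIV\<close> one
  gets every nonempty metric space. All notions below are intrinsic to \<open>X\<close>.
\<close>

text \<open>
  The supremum ranges over all subdivisions
  \<open>a = t 0 \<le> t 1 \<le> \<dots> \<le> t n = b\<close>. It is meant for \<open>a \<le> b\<close> and may be infinite.
\<close>

definition curve_length :: "(real \<Rightarrow> 'a::metric_space) \<Rightarrow> real \<Rightarrow> real \<Rightarrow> ereal" where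
  "curve_length \<gamma> a b =
     Sup {ereal (\<Sum>i<n. dist (\<gamma> (t i)) (\<gamma> (t (Suc i)))) | t n.
            mono_on {..n} t \<and> t 0 = a \<and> t n = b}"

definition curve_in :: "'a::metric_space set \<Rightarrow> (real \<Rightarrow> 'a) \<Rightarrow> real \<Rightarrow> real \<Rightarrow> bool" where
  "curve_in X \<gamma> a b \<longleftrightarrow> a \<le> b \<and> continuous_on {a..b} \<gamma> \<and> \<gamma> ` {a..b} \<subseteq> X"

text \<open>
  In \<^typ>\<open>ereal\<close> the infimum of the empty set is \<open>\<infinity>\<close>, so the condition forces any two
  points to be joined by a curve of finite length.
\<close>

definition path_metric_space :: "'a::metric_space set \<Rightarrow> bool" where
  "path_metric_space X \<longleftrightarrow>
     (\<forall>x\<in>X. \<forall>y\<in>X.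
        ereal (dist x y) =
          Inf {curve_length \<gamma> a b | \<gamma> a b. curve_in X \<gamma> a b \<and> \<gamma> a = x \<and> \<gamma> b = y})"

definition eps_geodesic ::
    "'a::metric_space set \<Rightarrow> real \<Rightarrow> (real \<Rightarrow> 'a) \<Rightarrow> real \<Rightarrow> real \<Rightarrow> bool" where
  "eps_geodesic X \<epsilon> \<gamma> a b \<longleftrightarrow>
     curve_in X \<gamma> a b \<and> curve_length \<gamma> a b \<le> ereal (dist (\<gamma> a) (\<gamma> b) + \<epsilon>)"

text \<open>
  A tripod with vertices \<open>\<mu> a\<close>, \<open>\<mu> b\<close>, \<open>\<gamma> u\<close> and center \<open>\<mu> c = \<gamma> v\<close>. Its legs are
  \<open>\<mu>\<close> on \<open>[a,c]\<close>, \<open>\<mu>\<close> on \<open>[c,b]\<close> (traversed backwards, which does not affect its length),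
  and \<open>\<gamma>\<close> on \<open>[u,v]\<close>. The parameter \<open>c\<close> records at which passage of \<open>\<mu>\<close> through
  the center the curve is cut.
\<close>

definition tripod ::
    "'a::metric_space set \<Rightarrow> real \<Rightarrow> (real \<Rightarrow> 'a) \<Rightarrow> real \<Rightarrow> real \<Rightarrow> real \<Rightarrow>
     (real \<Rightarrow> 'a) \<Rightarrow> real \<Rightarrow> real \<Rightarrow> bool" where
  "tripod X \<epsilon> \<mu> a c b \<gamma> u v \<longleftrightarrow>
     eps_geodesic X \<epsilon> \<mu> a b \<and> c \<in> {a..b} \<and>
     eps_geodesic X \<epsilon> \<gamma> u v \<and> \<gamma> v = \<mu> c \<and>
     (\<forall>t\<in>{a..b}. dist (\<gamma> u) (\<mu> c) \<le> dist (\<gamma> u) (\<mu> t) + \<epsilon>)"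

definition R_eps_tripod ::
    "'a::metric_space set \<Rightarrow> real \<Rightarrow> real \<Rightarrow> (real \<Rightarrow> 'a) \<Rightarrow> real \<Rightarrow> real \<Rightarrow> real \<Rightarrow>
     (real \<Rightarrow> 'a) \<Rightarrow> real \<Rightarrow> real \<Rightarrow> bool" where
  "R_eps_tripod X R \<epsilon> \<mu> a c b \<gamma> u v \<longleftrightarrow>
     tripod X \<epsilon> \<mu> a c b \<gamma> u v \<and>
     ereal R \<le> curve_length \<mu> a c \<and>
     ereal R \<le> curve_length \<mu> c b \<and>
     ereal R \<le> curve_length \<gamma> u v"

definition R_eps_compressed :: "'a::metric_space set \<Rightarrow> real \<Rightarrow> real \<Rightarrow> bool" where
  "R_eps_compressed X R \<epsilon> \<longleftrightarrow> \<not> (\<exists>\<mu> a c b \<gamma> u v. R_eps_tripod X R \<epsilon> \<mu> a c b \<gamma> u v)"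

definition uncompressed :: "'a::metric_space set \<Rightarrow> bool" where
  "uncompressed X \<longleftrightarrow> (\<forall>R \<epsilon>. \<epsilon> > 0 \<longrightarrow> \<not> R_eps_compressed X R \<epsilon>)"

definition compressed :: "'a::metric_space set \<Rightarrow> bool" where
  "compressed X \<longleftrightarrow> \<not> uncompressed X"

text \<open>
  The conjunct \<open>X \<noteq> {}\<close> is there because \<^const>\<open>infdist\<close> to the empty set is \<open>0\<close>
  by convention, whereas no point is at finite distance from the empty set.
\<close>

definition quasi_isometry ::
    "real \<Rightarrow> real \<Rightarrow> ('a::metric_space \<Rightarrow> 'b::metric_space) \<Rightarrow> 'a set \<Rightarrow> 'b set \<Rightarrow> bool" where
  "quasi_isometry L A f X Y \<longleftrightarrow>
     L \<ge> 1 \<and> f ` X \<subseteq> Y \<and>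
     (\<forall>x1\<in>X. \<forall>x2\<in>X.
        inverse L * dist x1 x2 - A \<le> dist (f x1) (f x2) \<and>
        dist (f x1) (f x2) \<le> L * dist x1 x2 + A) \<and>
     (\<forall>y\<in>Y. X \<noteq> {} \<and> infdist y (f ` X) \<le> A)"

definition quasi_isometric :: "'a::metric_space set \<Rightarrow> 'b::metric_space set \<Rightarrow> bool" where
  "quasi_isometric X Y \<longleftrightarrow> (\<exists>L A f. quasi_isometry L A f X Y)"

end

theory Submission
  imports Defs
begin

text \<open>
  Let \<open>X\<close> contain no \<open>(R, \<epsilon>)\<close>-tripods. A point at distance exactly \<open>R\<close> from an \<open>\<epsilon>\<close>-geodesic must
  project close to one of its ends, so the \<open>R\<close>-neighbourhood of an \<open>\<epsilon>\<close>-geodesic can be left only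
  through the \<open>2R\<close>-balls around its ends. Consequently all balls around a base point \<open>p\<close> lie in
  \<open>C\<close>-neighbourhoods of \<open>\<epsilon>\<close>-geodesics, with \<open>C\<close> independent of the radius. On such a ball the
  distance to the start of the \<open>\<epsilon>\<close>-geodesic distorts distances by a bounded additive error only.
  By compactness of products of intervals, these functions, normalised at a point, accumulate
  at a 1-Lipschitz function on \<open>X\<close> with the same property. Its image is an unbounded interval.
\<close>

section \<open>Metric estimates along \<epsilon>-geodesics\<close>

lemma curve_length_ge_three_dists:
  assumes "a \<le> s" "s \<le> t" "t \<le> b"
  shows "ereal (dist (\<gamma> a) (\<gamma> s) + dist (\<gamma> s) (\<gamma> t) + dist (\<gamma> t) (\<gamma> b)) \<le> curve_length \<gamma> a b"
proof -
  define u :: "nat \<Rightarrow> real"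
    where "u i = (if i = 0 then a else if i = 1 then s else if i = 2 then t else b)" for i
  have "mono_on {..3} u"
    using assms by (auto simp: mono_on_def u_def)
  moreover have "(\<Sum>i<3. dist (\<gamma> (u i)) (\<gamma> (u (Suc i)))) =
      dist (\<gamma> a) (\<gamma> s) + dist (\<gamma> s) (\<gamma> t) + dist (\<gamma> t) (\<gamma> b)"
    by (simp add: u_def numeral_3_eq_3)
  moreover have "u 0 = a" "u 3 = b"
    by (simp_all add: u_def)
  ultimately show ?thesis
    unfolding curve_length_def by (intro Sup_upper) (auto intro!: exI[of _ u] exI[of _ "3::nat"])
qed

lemma curve_length_ge_dist: "a \<le> b \<Longrightarrow> ereal (dist (\<gamma> a) (\<gamma> b)) \<le> curve_length \<gamma> a b"
  using curve_length_ge_three_dists[of a a b b \<gamma>] by simp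

lemma eps_geodesic_dist_le:
  assumes "eps_geodesic X \<epsilon> \<gamma> a b" "a \<le> s" "s \<le> t" "t \<le> b"
  shows "dist (\<gamma> a) (\<gamma> s) + dist (\<gamma> s) (\<gamma> t) + dist (\<gamma> t) (\<gamma> b) \<le> dist (\<gamma> a) (\<gamma> b) + \<epsilon>"
proof -
  have "ereal (dist (\<gamma> a) (\<gamma> s) + dist (\<gamma> s) (\<gamma> t) + dist (\<gamma> t) (\<gamma> b))
      \<le> ereal (dist (\<gamma> a) (\<gamma> b) + \<epsilon>)"
    using curve_length_ge_three_dists[OF assms(2-4), of \<gamma>] assms(1)
    unfolding eps_geodesic_def by (metis order_trans)
  then show ?thesis
    by simp
qed

text \<open>Up to \<epsilon>, the curve moves monotonically away from its start: for
  \<open>s \<le> t\<close>, bound \<open>dist (\<gamma> a) (\<gamma> b)\<close> by the triangle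
  inequality through \<open>\<gamma> t\<close> and cancel the last piece of the three-piece
  estimate.\<close>

lemma eps_geodesic_dist_to_start:
  assumes "eps_geodesic X \<epsilon> \<gamma> a b" "s \<in> {a..b}" "t \<in> {a..b}"
  shows "dist (\<gamma> s) (\<gamma> t) \<le> \<bar>dist (\<gamma> s) (\<gamma> a) - dist (\<gamma> t) (\<gamma> a)\<bar> + \<epsilon>"
proof -
  have ordered: "dist (\<gamma> s) (\<gamma> t) \<le> dist (\<gamma> t) (\<gamma> a) - dist (\<gamma> s) (\<gamma> a) + \<epsilon>"
    if "a \<le> s" "s \<le> t" "t \<le> b" for s t
    using eps_geodesic_dist_le[OF assms(1) that] dist_triangle[of "\<gamma> a" "\<gamma> b" "\<gamma> t"]
    by (simp add: dist_commute)
  show ?thesis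
    using ordered[of s t] ordered[of t s] assms(2,3)
    by (cases "s \<le> t") (auto simp: dist_commute abs_if)
qed

lemma eps_geodesic_image:
  assumes "eps_geodesic X \<epsilon> \<gamma> a b"
  shows "a \<le> b" "compact (\<gamma> ` {a..b})" "connected (\<gamma> ` {a..b})" "\<gamma> ` {a..b} \<subseteq> X"
    "\<gamma> a \<in> \<gamma> ` {a..b}" "\<gamma> b \<in> \<gamma> ` {a..b}"
  using assms unfolding eps_geodesic_def curve_in_def
  by (auto intro!: compact_continuous_image connected_continuous_image)

lemma eps_geodesic_exists:
  assumes "path_metric_space X" "x \<in> X" "y \<in> X" "\<epsilon> > 0"
  obtains \<gamma> a b where "eps_geodesic X \<epsilon> \<gamma> a b" "\<gamma> a = x" "\<gamma> b = y"
proof -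
  have "Inf {curve_length \<gamma> a b | \<gamma> a b. curve_in X \<gamma> a b \<and> \<gamma> a = x \<and> \<gamma> b = y} = ereal (dist x y)"
    using assms(1-3) unfolding path_metric_space_def by simp
  also have "\<dots> < ereal (dist x y + \<epsilon>)"
    using assms(4) by simp
  finally have "Inf {curve_length \<gamma> a b | \<gamma> a b. curve_in X \<gamma> a b \<and> \<gamma> a = x \<and> \<gamma> b = y}
      < ereal (dist x y + \<epsilon>)" .
  then obtain \<gamma> a b where "curve_in X \<gamma> a b" "\<gamma> a = x" "\<gamma> b = y"
      "curve_length \<gamma> a b < ereal (dist x y + \<epsilon>)"
    by (auto simp: Inf_less_iff)
  then show ?thesis
    by (intro that[of \<gamma> a b]) (auto simp: eps_geodesic_def)
qed

lemma path_metric_space_connected: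
  assumes "path_metric_space X"
  shows "connected X"
proof -
  have "connected_component X x y" if xy: "x \<in> X" "y \<in> X" for x y
  proof -
    obtain \<gamma> a b where "eps_geodesic X 1 \<gamma> a b" "\<gamma> a = x" "\<gamma> b = y"
      using eps_geodesic_exists[OF assms xy zero_less_one] .
    then show ?thesis
      using eps_geodesic_image[of X 1 \<gamma> a b] unfolding connected_component_def by blast
  qed
  then show ?thesis
    by (auto simp: connected_iff_connected_component)
qed

lemma compressed_imp_R_eps_compressed:
  assumes "compressed X"
  obtains R \<epsilon> where "R > 0" "\<epsilon> > 0" "R_eps_compressed X R \<epsilon>"
proof -
  obtain R \<epsilon> where \<epsilon>: "\<epsilon> > 0" and R: "R_eps_compressed X R \<epsilon>"
    using assms unfolding compressed_def uncompressed_def by blast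
  \<comment> \<open>Enlarging \<open>R\<close> only strengthens the length condition on the legs, so
    fewer tripods qualify. This makes \<open>R\<close> positive.\<close>
  have "ereal R \<le> l" if "ereal (max R 1) \<le> l" for l
    using that by (metis ereal_less_eq(3) max.cobounded1 order_trans)
  then have "R_eps_compressed X (max R 1) \<epsilon>"
    using R unfolding R_eps_compressed_def R_eps_tripod_def by blast
  then show ?thesis
    using \<epsilon> by (intro that[of "max R 1" \<epsilon>]) auto
qed

section \<open>Nearest points and escape from neighbourhoods of \<epsilon>-geodesics\<close>

lemma infdist_compact_attained:
  fixes S :: "'a::metric_space set"
  assumes "compact S" "S \<noteq> {}"
  obtains c where "c \<in> S" "infdist v S = dist v c" "\<And>w. w \<in> S \<Longrightarrow> dist v c \<le> dist v w"
proof -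
  obtain c where c: "c \<in> S" "\<And>w. w \<in> S \<Longrightarrow> dist v c \<le> dist v w"
    using continuous_attains_inf[OF assms continuous_on_dist[OF continuous_on_const continuous_on_id]]
    by blast
  then have "infdist v S = dist v c"
    using assms(2) by (intro antisym infdist_le) (auto simp: infdist_def intro!: cINF_greatest)
  then show ?thesis
    using c that by blast
qed

text \<open>
  A point projecting to the interior of an \<open>\<epsilon>\<close>-geodesic from distance \<open>R\<close> would span a tripod.
\<close>

lemma dist_ends_if_infdist_eq:
  assumes X: "path_metric_space X" "\<epsilon> > 0" "R_eps_compressed X R \<epsilon>"
    and \<mu>: "eps_geodesic X \<epsilon> \<mu> a b"
    and v: "v \<in> X" "infdist v (\<mu> ` {a..b}) = R"
  shows "dist v (\<mu> a) < 2 * R \<or> dist v (\<mu> b) < 2 * R"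
proof (rule ccontr)
  assume far: "\<not> ?thesis"
  obtain c where c: "c \<in> {a..b}" and R: "dist v (\<mu> c) = R"
    and nearest: "\<And>t. t \<in> {a..b} \<Longrightarrow> dist v (\<mu> c) \<le> dist v (\<mu> t)"
  proof -
    obtain w where "w \<in> \<mu> ` {a..b}" "infdist v (\<mu> ` {a..b}) = dist v w"
      "\<And>w'. w' \<in> \<mu> ` {a..b} \<Longrightarrow> dist v w \<le> dist v w'"
      using infdist_compact_attained[OF eps_geodesic_image(2)[OF \<mu>], of v]
        eps_geodesic_image(5)[OF \<mu>] by (metis empty_iff)
    then show ?thesis
      using that v(2) by auto
  qed
  have "\<mu> c \<in> X"
    using eps_geodesic_image(4)[OF \<mu>] c by blast
  then obtain \<gamma> u w where \<gamma>: "eps_geodesic X \<epsilon> \<gamma> u w" "\<gamma> u = v" "\<gamma> w = \<mu> c"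
    using eps_geodesic_exists[OF X(1) v(1) _ X(2)] by blast
  \<comment> \<open>The ends are at least \<open>2 * R\<close> away from \<open>v\<close> and the
    nearest point \<open>\<mu> c\<close> exactly \<open>R\<close>, which leaves \<open>R\<close> for
    each leg on \<open>\<mu>\<close>.\<close>
  have ends: "R \<le> dist (\<mu> a) (\<mu> c)" "R \<le> dist (\<mu> c) (\<mu> b)"
    using far R dist_triangle[of v "\<mu> a" "\<mu> c"] dist_triangle[of v "\<mu> b" "\<mu> c"]
    by (auto simp: dist_commute)
  have long: "ereal R \<le> curve_length \<eta> s t" if "s \<le> t" "R \<le> dist (\<eta> s) (\<eta> t)" for \<eta> :: "real \<Rightarrow> 'a" and s t
    using curve_length_ge_dist[OF that(1), of \<eta>] that(2) by (metis ereal_less_eq(3) order_trans)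
  have "tripod X \<epsilon> \<mu> a c b \<gamma> u w"
    using \<mu> \<gamma> c nearest X(2) by (force simp: tripod_def)
  moreover have "ereal R \<le> curve_length \<mu> a c" "ereal R \<le> curve_length \<mu> c b" "ereal R \<le> curve_length \<gamma> u w"
    using long[of a c \<mu>] long[of c b \<mu>] long[of u w \<gamma>] ends c R \<gamma>(2,3)
      eps_geodesic_image(1)[OF \<gamma>(1)] by simp_all
  ultimately show False
    using X(3) unfolding R_eps_compressed_def R_eps_tripod_def by blast
qed

lemma connected_image_IVT:
  fixes f :: "'a \<Rightarrow> real"
  assumes "connected (f ` S)" "x \<in> S" "f x \<le> r" "y \<in> S" "r \<le> f y"
  obtains v where "v \<in> S" "f v = r"
proof -
  have "r \<in> f ` S"
    using connectedD_interval[OF assms(1) imageI[OF assms(2)] imageI[OF assms(4)]] assms(3,5) by blast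
  then show ?thesis
    using that by blast
qed

text \<open>The distance to the curve is continuous, so on the connected set \<open>S\<close> it
  takes the value \<open>R\<close>; at such a point the absence of tripods forces an end to be
  close.\<close>

lemma connected_leaving_nbhd_meets_ends:
  assumes X: "path_metric_space X" "\<epsilon> > 0" "R_eps_compressed X R \<epsilon>"
    and \<mu>: "eps_geodesic X \<epsilon> \<mu> a b"
    and S: "connected S" "S \<subseteq> X"
    and x: "x \<in> S" "infdist x (\<mu> ` {a..b}) \<le> R"
    and y: "y \<in> S" "R \<le> infdist y (\<mu> ` {a..b})"
  obtains v where "v \<in> S" "dist v (\<mu> a) < 2 * R \<or> dist v (\<mu> b) < 2 * R"
proof -
  have "connected ((\<lambda>v. infdist v (\<mu> ` {a..b})) ` S)"
    using S(1) by (intro connected_continuous_image continuous_intros)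
  then obtain v where "v \<in> S" "infdist v (\<mu> ` {a..b}) = R"
    using connected_image_IVT[OF _ x y] by blast
  then show ?thesis
    using that dist_ends_if_infdist_eq[OF X \<mu>] S(2) by blast
qed

section \<open>Balls inside neighbourhoods of \<epsilon>-geodesics\<close>

lemma eps_geodesic_dist_via:
  assumes "eps_geodesic X \<epsilon> \<gamma> a b" "v \<in> \<gamma> ` {a..b}"
  shows "dist (\<gamma> a) v + dist v (\<gamma> b) \<le> dist (\<gamma> a) (\<gamma> b) + \<epsilon>"
  using eps_geodesic_dist_le[OF assms(1), of _ b] assms(2) by force

text \<open>An \<epsilon>-geodesic from \<open>w\<close> to a point \<open>q\<close> off the
  neighbourhood would have to pass within \<open>2 * R\<close> of an end of \<open>\<mu>\<close>,
  but it stays too close to \<open>p\<close> for that.\<close>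

lemma ball_near_two_sided_eps_geodesic:
  assumes X: "path_metric_space X" "\<epsilon> > 0" "R > 0" "R_eps_compressed X R \<epsilon>"
    and \<mu>: "eps_geodesic X \<epsilon> \<mu> a b"
    and w: "w \<in> \<mu> ` {a..b}" "dist p w \<le> 2 * R"
    and far: "s + 6 * R + \<epsilon> \<le> dist p (\<mu> a)" "s + 6 * R + \<epsilon> \<le> dist p (\<mu> b)"
    and q: "q \<in> X" "dist p q \<le> s"
  shows "infdist q (\<mu> ` {a..b}) < R"
proof (rule ccontr)
  assume "\<not> ?thesis"
  moreover have "w \<in> X"
    using w(1) eps_geodesic_image(4)[OF \<mu>] by blast
  then obtain \<gamma> u v where \<gamma>: "eps_geodesic X \<epsilon> \<gamma> u v" "\<gamma> u = w" "\<gamma> v = q"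
    using eps_geodesic_exists[OF X(1) _ q(1) X(2)] by blast
  moreover have "infdist w (\<mu> ` {a..b}) = 0"
    using w(1) by simp
  ultimately obtain z where z: "z \<in> \<gamma> ` {u..v}" "dist z (\<mu> a) < 2 * R \<or> dist z (\<mu> b) < 2 * R"
    using connected_leaving_nbhd_meets_ends[OF X(1,2,4) \<mu> eps_geodesic_image(3,4)[OF \<gamma>(1)], of w q]
      eps_geodesic_image(5,6)[OF \<gamma>(1)] X(3) by (metis less_imp_le linorder_not_less)
  have "dist w z \<le> dist w q + \<epsilon>"
    using eps_geodesic_dist_via[OF \<gamma>(1) z(1), unfolded \<gamma>(2,3)] zero_le_dist[of z q] by linarith
  also have "dist w q \<le> 2 * R + s"
    using dist_triangle[of w q p] w(2) q(2) by (simp add: dist_commute)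
  finally have "dist p z \<le> 4 * R + s + \<epsilon>"
    using dist_triangle[of p z w] w(2) by simp
  \<comment> \<open>Another \<open>2 * R\<close> from \<open>z\<close> to an end stays below the
    \<open>s + 6 * R + \<epsilon>\<close> required in \<open>far\<close>.\<close>
  then show False
    using z(2) far dist_triangle[of p "\<mu> a" z] dist_triangle[of p "\<mu> b" z] by linarith
qed

text \<open>
  If no \<open>\<epsilon>\<close>-geodesic passes close to \<open>p\<close> with both ends far from \<open>p\<close>, a point off the
  \<open>\<epsilon>\<close>-geodesic from \<open>p\<close> to \<open>y\<close> can only be joined to it by passing near \<open>p\<close>, which bounds its
  distance from \<open>p\<close>.
\<close>

lemma ball_near_one_sided_eps_geodesic:
  assumes X: "path_metric_space X" "\<epsilon> > 0" "R > 0" "R_eps_compressed X R \<epsilon>"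
    and bound: "\<And>\<mu> a b w. eps_geodesic X \<epsilon> \<mu> a b \<Longrightarrow> w \<in> \<mu> ` {a..b} \<Longrightarrow> dist p w \<le> 2 * R \<Longrightarrow>
        dist p (\<mu> a) < T \<or> dist p (\<mu> b) < T"
    and \<kappa>: "eps_geodesic X \<epsilon> \<kappa> a b" "\<kappa> a = p" and "T \<ge> 0" "s \<ge> 0"
    and y: "s + 2 * R + \<epsilon> + 2 * T \<le> dist p (\<kappa> b)"
    and q: "q \<in> X" "dist p q \<le> s"
  shows "infdist q (\<kappa> ` {a..b}) < max R T"
proof (rule ccontr)
  assume off: "\<not> ?thesis"
  have "connected (dist p ` \<kappa> ` {a..b})"
    by (intro connected_continuous_image[OF _ eps_geodesic_image(3)[OF \<kappa>(1)]] continuous_intros)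
  \<comment> \<open>The distance to \<open>p\<close> runs along \<open>\<kappa>\<close> from 0 to
    beyond \<open>T\<close>. The value \<open>T\<close> is chosen so that \<open>bound\<close>,
    applied to a curve starting at \<open>x\<close>, can only speak of its other end.\<close>
  then obtain x where x: "x \<in> \<kappa> ` {a..b}" "dist p x = T"
    using eps_geodesic_image(5,6)[OF \<kappa>(1)] \<kappa>(2) y X(2,3) \<open>T \<ge> 0\<close> \<open>s \<ge> 0\<close>
    by (elim connected_image_IVT[of "dist p" _ p T "\<kappa> b"]) auto
  have "x \<in> X"
    using x(1) eps_geodesic_image(4)[OF \<kappa>(1)] by blast
  then obtain \<nu> u v where \<nu>: "eps_geodesic X \<epsilon> \<nu> u v" "\<nu> u = x" "\<nu> v = q"
    using eps_geodesic_exists[OF X(1) _ q(1) X(2)] by blast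
  have "infdist x (\<kappa> ` {a..b}) \<le> R" "R \<le> infdist q (\<kappa> ` {a..b})"
    using x(1) X(3) off by auto
  then obtain z where z: "z \<in> \<nu> ` {u..v}" "dist z p < 2 * R \<or> dist z (\<kappa> b) < 2 * R"
    using connected_leaving_nbhd_meets_ends[OF X(1,2,4) \<kappa>(1) eps_geodesic_image(3,4)[OF \<nu>(1)], of x q]
      eps_geodesic_image(5,6)[OF \<nu>(1)] \<nu>(2,3) \<kappa>(2) by metis
  have "dist x z \<le> dist x q + \<epsilon>"
    using eps_geodesic_dist_via[OF \<nu>(1) z(1), unfolded \<nu>(2,3)] zero_le_dist[of z q] by linarith
  also have "dist x q \<le> T + s"
    using dist_triangle[of x q p] x(2) q(2) by (simp add: dist_commute)
  finally have "dist p z \<le> 2 * T + s + \<epsilon>"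
    using dist_triangle[of p z x] x(2) by simp
  \<comment> \<open>If \<open>z\<close> were near \<open>\<kappa> b\<close>, that end would be
    closer to \<open>p\<close> than \<open>y\<close> permits.\<close>
  then have "dist p z \<le> 2 * R"
    using z(2) y dist_triangle[of p "\<kappa> b" z] by (auto simp: dist_commute)
  \<comment> \<open>\<open>\<nu>\<close> passes near \<open>p\<close> at \<open>z\<close>, and its
    end \<open>x\<close> is not within \<open>T\<close>, so \<open>q\<close> is.\<close>
  then have "dist p q < T"
    using bound[OF \<nu>(1) z(1)] \<nu>(2,3) x(2) by auto
  moreover have "infdist q (\<kappa> ` {a..b}) \<le> dist q p"
    using eps_geodesic_image(5)[OF \<kappa>(1)] \<kappa>(2) by (intro infdist_le) simp
  ultimately show False
    using off by (simp add: dist_commute)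
qed

text \<open>Either \<epsilon>-geodesics passing within \<open>2 * R\<close> of \<open>p\<close> can
  have both ends arbitrarily far from \<open>p\<close>, and \<open>C = R\<close> works, or some
  \<open>T\<close> bounds the distance of one end, and \<epsilon>-geodesics issuing from
  \<open>p\<close> work with \<open>C = max R T\<close>.\<close>

lemma balls_near_eps_geodesics:
  assumes X: "path_metric_space X" "\<not> bounded X" "\<epsilon> > 0" "R > 0" "R_eps_compressed X R \<epsilon>"
    and p: "p \<in> X"
  shows "\<exists>C. \<forall>s. \<exists>\<mu> a b. eps_geodesic X \<epsilon> \<mu> a b \<and>
    (\<forall>q\<in>X. dist p q \<le> s \<longrightarrow> infdist q (\<mu> ` {a..b}) < C)"
proof (cases "\<forall>T. \<exists>\<mu> a b w. eps_geodesic X \<epsilon> \<mu> a b \<and> w \<in> \<mu> ` {a..b} \<and> dist p w \<le> 2 * R \<and>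
    T \<le> dist p (\<mu> a) \<and> T \<le> dist p (\<mu> b)")
  case True
  have "\<exists>\<mu> a b. eps_geodesic X \<epsilon> \<mu> a b \<and> (\<forall>q\<in>X. dist p q \<le> s \<longrightarrow> infdist q (\<mu> ` {a..b}) < R)" for s
    using True[rule_format, of "s + 6 * R + \<epsilon>"] ball_near_two_sided_eps_geodesic[OF X(1,3,4,5)] by meson
  then show ?thesis
    by blast
next
  case False
  then obtain T' where T': "\<And>\<mu> a b w. eps_geodesic X \<epsilon> \<mu> a b \<Longrightarrow> w \<in> \<mu> ` {a..b} \<Longrightarrow>
      dist p w \<le> 2 * R \<Longrightarrow> dist p (\<mu> a) < T' \<or> dist p (\<mu> b) < T'"
    by (meson linorder_not_less)
  define T where "T = max T' 0"
  have T: "dist p (\<mu> a) < T \<or> dist p (\<mu> b) < T"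
    if "eps_geodesic X \<epsilon> \<mu> a b" "w \<in> \<mu> ` {a..b}" "dist p w \<le> 2 * R" for \<mu> a b w
    using T'[OF that] by (auto simp: T_def)
  have "T \<ge> 0"
    by (simp add: T_def)
  have "\<exists>\<mu> a b. eps_geodesic X \<epsilon> \<mu> a b \<and>
      (\<forall>q\<in>X. dist p q \<le> s \<longrightarrow> infdist q (\<mu> ` {a..b}) < max R T)" for s
  proof -
    \<comment> \<open>The radius \<open>s\<close> may be negative; \<open>max s 0\<close> ensures
      that \<open>y\<close> is farther than \<open>T\<close> from \<open>p\<close>.\<close>
    obtain y where y: "y \<in> X" "max s 0 + 2 * R + \<epsilon> + 2 * T < dist p y"
      using X(2) unfolding bounded_def by (meson linorder_not_less)
    obtain \<kappa> a b where \<kappa>: "eps_geodesic X \<epsilon> \<kappa> a b" "\<kappa> a = p" "\<kappa> b = y"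
      using eps_geodesic_exists[OF X(1) p y(1) X(3)] .
    have "infdist q (\<kappa> ` {a..b}) < max R T" if "q \<in> X" "dist p q \<le> s" for q
      by (rule ball_near_one_sided_eps_geodesic[where s = "max s 0", OF X(1,3,4,5) T \<kappa>(1,2) \<open>T \<ge> 0\<close>])
        (use that y \<kappa>(3) in auto)
    then show ?thesis
      using \<kappa>(1) by blast
  qed
  then show ?thesis
    by blast
qed

section \<open>Almost isometric real functions and their limits\<close>

text \<open>Replacing \<open>q\<close> and \<open>q'\<close> by points of the curve costs
  \<open>2 * C\<close> in their distance and \<open>2 * C\<close> in the difference of distances to
  \<open>\<mu> a\<close>; on the curve itself the error is \<epsilon>.\<close>

lemma dist_le_near_eps_geodesic:
  assumes \<mu>: "eps_geodesic X \<epsilon> \<mu> a b"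
    and q: "infdist q (\<mu> ` {a..b}) < C" "infdist q' (\<mu> ` {a..b}) < C"
  shows "dist q q' - (4 * C + \<epsilon>) \<le> \<bar>dist q (\<mu> a) - dist q' (\<mu> a)\<bar>"
proof -
  have near: "\<exists>t\<in>{a..b}. dist z (\<mu> t) < C" if "infdist z (\<mu> ` {a..b}) < C" for z
  proof -
    obtain w where "w \<in> \<mu> ` {a..b}" "infdist z (\<mu> ` {a..b}) = dist z w"
      using infdist_compact_attained[OF eps_geodesic_image(2)[OF \<mu>]] eps_geodesic_image(5)[OF \<mu>]
      by (metis empty_iff)
    then show ?thesis
      using that by auto
  qed
  obtain t t' where t: "t \<in> {a..b}" "dist q (\<mu> t) < C" "t' \<in> {a..b}" "dist q' (\<mu> t') < C"
    using near q by blast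
  have "dist q q' \<le> dist q (\<mu> t) + dist (\<mu> t) (\<mu> t') + dist q' (\<mu> t')"
    using dist_triangle[of q q' "\<mu> t"] dist_triangle[of "\<mu> t" q' "\<mu> t'"] by (simp add: dist_commute)
  moreover have "\<bar>dist q (\<mu> a) - dist (\<mu> t) (\<mu> a)\<bar> \<le> dist q (\<mu> t)"
    "\<bar>dist q' (\<mu> a) - dist (\<mu> t') (\<mu> a)\<bar> \<le> dist q' (\<mu> t')"
    using abs_dist_diff_le[of q "\<mu> a" "\<mu> t"] abs_dist_diff_le[of q' "\<mu> a" "\<mu> t'"]
    by (simp_all add: dist_commute)
  ultimately show ?thesis
    using eps_geodesic_dist_to_start[OF \<mu> t(1,3)] t(2,4) by linarith
qed

text \<open>A cluster point in the topology of pointwise convergence replaces a convergent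
  subsequence, which an uncountable product of intervals need not provide. Both inequalities are
  closed conditions on two coordinates, so they survive.\<close>

lemma lipschitz_limit:
  fixes f :: "nat \<Rightarrow> 'a::metric_space \<Rightarrow> real"
  assumes lip: "\<And>n x y. \<bar>f n x - f n y\<bar> \<le> dist x y"
    and lower: "\<And>x y. x \<in> X \<Longrightarrow> y \<in> X \<Longrightarrow> \<forall>\<^sub>F n in sequentially. dist x y - A \<le> \<bar>f n x - f n y\<bar>"
  obtains g :: "'a \<Rightarrow> real"
  where "\<And>x y. \<bar>g x - g y\<bar> \<le> dist x y"
    and "\<And>x y. x \<in> X \<Longrightarrow> y \<in> X \<Longrightarrow> dist x y - A \<le> \<bar>g x - g y\<bar>"
proof -
  \<comment> \<open>An arbitrary base point; subtracting the value there confines each coordinate to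
    a fixed compact interval.\<close>
  define p :: 'a where "p = undefined"
  define K where "K = PiE UNIV (\<lambda>x::'a. {- dist x p..dist x p})"
  define h where "h n x = f n x - f n p" for n x
  \<comment> \<open>Tychonoff, after rewriting the type class topology on functions as a product
    topology.\<close>
  have "compact K"
    unfolding K_def compactin_euclidean_iff[symmetric] euclidean_product_topology[symmetric] compactin_PiE
    by simp
  have "h n \<in> K" for n
  proof -
    have "h n x \<in> {- dist x p..dist x p}" for x
      using lip[of n x p] unfolding h_def by (auto simp: abs_le_iff)
    then show ?thesis
      by (simp add: K_def PiE_UNIV_domain)
  qed
  then have "eventually (\<lambda>g. g \<in> K) (filtermap h sequentially)"
    by (simp add: eventually_filtermap)
  then obtain g where g: "inf (nhds g) (filtermap h sequentially) \<noteq> bot"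
    using \<open>compact K\<close> unfolding compact_filter by (metis filtermap_bot_iff trivial_limit_sequentially)
  \<comment> \<open>A cluster point lies in every closed set that eventually contains the
    sequence.\<close>
  have limit: "g \<in> S" if "closed S" "\<forall>\<^sub>F n in sequentially. h n \<in> S" for S
  proof (rule ccontr)
    assume "g \<notin> S"
    then have "eventually (\<lambda>k. k \<in> - S) (nhds g)"
      using that(1) by (intro eventually_nhds_in_open) auto
    moreover have "eventually (\<lambda>k. k \<in> S) (filtermap h sequentially)"
      using that(2) by (simp add: eventually_filtermap)
    ultimately have "eventually (\<lambda>_. False) (inf (nhds g) (filtermap h sequentially))"
      unfolding eventually_inf by (metis ComplD)
    then show False
      using g by (simp add: trivial_limit_def)
  qed
  have cont: "continuous_on UNIV (\<lambda>k::'a \<Rightarrow> real. \<bar>k x - k y\<bar>)" for x y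
    by (intro continuous_intros continuous_on_product_coordinates)
  show ?thesis
  proof
    fix x y
    have "g \<in> {k. \<bar>k x - k y\<bar> \<le> dist x y}"
      by (rule limit) (use lip in \<open>auto intro!: closed_Collect_le cont simp: h_def\<close>)
    then show "\<bar>g x - g y\<bar> \<le> dist x y"
      by simp
  next
    fix x y assume "x \<in> X" "y \<in> X"
    then have "g \<in> {k. dist x y - A \<le> \<bar>k x - k y\<bar>}"
      by (intro limit) (use lower in \<open>auto intro!: closed_Collect_le cont simp: h_def\<close>)
    then show "dist x y - A \<le> \<bar>g x - g y\<bar>"
      by simp
  qed
qed

section \<open>From almost isometric functions to quasi-isometries\<close>

lemma connected_image_lipschitz:
  fixes f :: "'a::metric_space \<Rightarrow> real"
  assumes "connected X" and lip: "\<And>x y. \<bar>f x - f y\<bar> \<le> dist x y"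
  shows "connected (f ` X)"
proof -
  have "1-lipschitz_on X f"
    using lip by (auto simp: lipschitz_on_def dist_real_def)
  then show ?thesis
    using assms(1) lipschitz_on_continuous_on connected_continuous_image by blast
qed

lemma quasi_isometric_half_line:
  fixes f :: "'a::metric_space \<Rightarrow> real"
  assumes X: "connected X" "X \<noteq> {}"
    and lip: "\<And>x y. \<bar>f x - f y\<bar> \<le> dist x y"
    and lower: "\<And>x y. x \<in> X \<Longrightarrow> y \<in> X \<Longrightarrow> dist x y - A \<le> \<bar>f x - f y\<bar>"
    and f: "bdd_below (f ` X)" "\<not> bdd_above (f ` X)"
  shows "quasi_isometric X {0::real..}"
proof -
  define m where "m = Inf (f ` X)"
  have conn: "connected (f ` X)"
    using connected_image_lipschitz[OF X(1) lip] .
  have m: "m \<le> f x" if "x \<in> X" for x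
    using that f(1) by (auto simp: m_def intro: cInf_lower)
  have onto: "r \<in> f ` X" if "r > m" for r
  proof -
    have "Inf (f ` X) < r"
      using that by (simp add: m_def)
    then obtain x where "x \<in> X" "f x < r"
      using cInf_lessD[of "f ` X" "r"] X(2) by blast
    moreover obtain y where "y \<in> X" "r < f y"
      using f(2) by (auto simp: bdd_above_def not_le)
    ultimately show ?thesis
      using connected_image_IVT[OF conn, of x r y] by force
  qed
  have "quasi_isometry 1 (max A 1) (\<lambda>x. f x - m) X {0..}"
    unfolding quasi_isometry_def
  proof (intro conjI ballI)
    fix x1 x2 assume x: "x1 \<in> X" "x2 \<in> X"
    show "inverse 1 * dist x1 x2 - max A 1 \<le> dist (f x1 - m) (f x2 - m)"
      using lower[OF x] by (simp add: dist_real_def)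
    show "dist (f x1 - m) (f x2 - m) \<le> 1 * dist x1 x2 + max A 1"
      using lip[of x1 x2] by (simp add: dist_real_def)
  next
    fix y :: real assume y: "y \<in> {0..}"
    \<comment> \<open>The infimum \<open>m\<close> may not be attained, so \<open>y + 1\<close> is
      hit instead of \<open>y\<close>; hence the 1 in \<open>max A 1\<close>.\<close>
    obtain x where x: "x \<in> X" "f x = m + (y + 1)"
      using onto[of "m + (y + 1)"] y by force
    then have "infdist y ((\<lambda>x. f x - m) ` X) \<le> dist y (f x - m)"
      by (intro infdist_le imageI)
    then show "infdist y ((\<lambda>x. f x - m) ` X) \<le> max A 1"
      using x(2) by (simp add: dist_real_def)
  qed (use m X(2) in auto)
  then show ?thesis
    unfolding quasi_isometric_def by blast
qed

lemma quasi_isometric_line_or_half_line: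
  fixes f :: "'a::metric_space \<Rightarrow> real"
  assumes X: "connected X" "\<not> bounded X"
    and lip: "\<And>x y. \<bar>f x - f y\<bar> \<le> dist x y"
    and lower: "\<And>x y. x \<in> X \<Longrightarrow> y \<in> X \<Longrightarrow> dist x y - A \<le> \<bar>f x - f y\<bar>"
  shows "quasi_isometric X (UNIV :: real set) \<or> quasi_isometric X {0::real..}"
proof -
  have "X \<noteq> {}"
    using X(2) by auto
  consider "bdd_below (f ` X)" "bdd_above (f ` X)" | "bdd_below (f ` X)" "\<not> bdd_above (f ` X)"
    | "\<not> bdd_below (f ` X)" "bdd_above (f ` X)" | "\<not> bdd_below (f ` X)" "\<not> bdd_above (f ` X)"
    by argo
  then show ?thesis
  proof cases
    \<comment> \<open>Impossible: distances in \<open>X\<close> exceed differences of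
      \<open>f\<close> by at most \<open>A\<close>, so a bounded image would make \<open>X\<close>
      bounded.\<close>
    case 1
    then obtain l u where lu: "\<And>x. x \<in> X \<Longrightarrow> l \<le> f x" "\<And>x. x \<in> X \<Longrightarrow> f x \<le> u"
      by (auto simp: bdd_below_def bdd_above_def)
    have "dist x y \<le> u - l + A" if "x \<in> X" "y \<in> X" for x y
      using lower[OF that] lu[OF that(1)] lu[OF that(2)] by linarith
    then have "bounded X"
      using \<open>X \<noteq> {}\<close> unfolding bounded_def by blast
    then show ?thesis
      using X(2) by blast
  next
    case 2
    then show ?thesis
      using quasi_isometric_half_line[OF X(1) \<open>X \<noteq> {}\<close>, of f A] lip lower by simp
  next
    \<comment> \<open>Reflection \<open>- f\<close> reduces this to the previous case.\<close>
    case 3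
    have "\<bar>- f x - - f y\<bar> = \<bar>f x - f y\<bar>" for x y
      by simp
    moreover have "bdd_below ((\<lambda>x. - f x) ` X)" "\<not> bdd_above ((\<lambda>x. - f x) ` X)"
      using 3 bdd_above_uminus[of "f ` X"] bdd_below_uminus[of "f ` X"] by (auto simp: image_image)
    ultimately show ?thesis
      using quasi_isometric_half_line[OF X(1) \<open>X \<noteq> {}\<close>, of "\<lambda>x. - f x" A] lip lower by simp
  next
    case 4
    have conn: "connected (f ` X)"
      using connected_image_lipschitz[OF X(1) lip] .
    have onto: "r \<in> f ` X" for r
    proof -
      obtain x y where "x \<in> X" "f x < r" "y \<in> X" "r < f y"
        using 4 unfolding bdd_above_def bdd_below_def by (metis imageE not_le)
      then show ?thesis
        using connected_image_IVT[OF conn, of x r y] by force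
    qed
    then have "f ` X = UNIV"
      by blast
    moreover have "inverse 1 * dist x y - max A 0 \<le> dist (f x) (f y) \<and>
        dist (f x) (f y) \<le> 1 * dist x y + max A 0" if "x \<in> X" "y \<in> X" for x y
      using lip[of x y] lower[OF that] by (simp add: dist_real_def)
    ultimately have "quasi_isometry 1 (max A 0) f X UNIV"
      using \<open>X \<noteq> {}\<close> unfolding quasi_isometry_def by simp
    then show ?thesis
      unfolding quasi_isometric_def by blast
  qed
qed

theorem theorem5:
  fixes X :: "'a::metric_space set"
  assumes "path_metric_space X"
    and "\<not> bounded X"
    and "compressed X"
  shows "quasi_isometric X (UNIV :: real set) \<or> quasi_isometric X {0::real..}"
proof -
  obtain R \<epsilon> where R: "\<epsilon> > 0" "R > 0" "R_eps_compressed X R \<epsilon>"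
    using compressed_imp_R_eps_compressed[OF assms(3)] .
  obtain p where p: "p \<in> X"
    using assms(2) by fastforce
  obtain C where C: "\<And>s. \<exists>\<mu> a b. eps_geodesic X \<epsilon> \<mu> a b \<and>
      (\<forall>q\<in>X. dist p q \<le> s \<longrightarrow> infdist q (\<mu> ` {a..b}) < C)"
    using balls_near_eps_geodesics[OF assms(1,2) R p] by blast
  \<comment> \<open>The witness is the start of an \<epsilon>-geodesic serving the ball of radius
    \<open>n\<close>. Any fixed pair of points lies in these balls for all large \<open>n\<close>,
    while the error is independent of \<open>n\<close>.\<close>
  have "\<exists>z. \<forall>x\<in>X. \<forall>y\<in>X. dist p x \<le> real n \<longrightarrow> dist p y \<le> real n \<longrightarrow>
      dist x y - (4 * C + \<epsilon>) \<le> \<bar>dist x z - dist y z\<bar>" for n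
    using C[of "real n"] dist_le_near_eps_geodesic by meson
  then obtain z where z: "\<And>n x y. x \<in> X \<Longrightarrow> y \<in> X \<Longrightarrow> dist p x \<le> real n \<Longrightarrow> dist p y \<le> real n \<Longrightarrow>
      dist x y - (4 * C + \<epsilon>) \<le> \<bar>dist x (z n) - dist y (z n)\<bar>"
    by metis
  have "\<forall>\<^sub>F n in sequentially. dist x y - (4 * C + \<epsilon>) \<le> \<bar>dist x (z n) - dist y (z n)\<bar>"
    if "x \<in> X" "y \<in> X" for x y
  proof -
    have "\<forall>\<^sub>F n in sequentially. max (dist p x) (dist p y) \<le> real n"
      using eventually_ge_at_top[of "nat \<lceil>max (dist p x) (dist p y)\<rceil>"]
      by eventually_elim linarith
    then show ?thesis
      by eventually_elim (use z that in auto)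
  qed
  moreover have "\<bar>dist x (z n) - dist y (z n)\<bar> \<le> dist x y" for n x y
    using abs_dist_diff_le[of x "z n" y] by (simp add: dist_commute)
  ultimately obtain g where "\<And>x y. \<bar>g x - g y\<bar> \<le> dist x y"
    and "\<And>x y. x \<in> X \<Longrightarrow> y \<in> X \<Longrightarrow> dist x y - (4 * C + \<epsilon>) \<le> \<bar>g x - g y\<bar>"
    using lipschitz_limit[of "\<lambda>n x. dist x (z n)" X "4 * C + \<epsilon>"] by blast
  then show ?thesis
    by (rule quasi_isometric_line_or_half_line[OF path_metric_space_connected[OF assms(1)] assms(2)])
qed

end
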